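(* Let $\alpha>0$ and, for $\square\in\{+,*,\sharp\}$, consider the approximation problem given by the embeddings $$\mathrm{id}_d\colon H^{\alpha,\square}(\mathbb{T}^d)\to L_2(\mathbb{T}^d),\qquad d\in\mathbb{N},$$ with respect to the worst case setting and information from $\Lambda^{\mathrm{all}}$. (i) In the case $\square=+$ the problem is $(s,t)$-weakly tractable if and only if $$\left(s>\tfrac{2}{\alpha}\text{ and }t>0\right)\quad\text{or}\quad\left(s>0\text{ and }t>1\right).$$ (ii) In the case $\square=*$: 1.) $(s,t)$-weak tractability implies that $(s>2$ and $t>0)$ or $(s>0$ and $t>1)$; 2.) the conditions $\left(s>\max\{2,\tfrac1\alpha\}\text{ and }t>0\right)$ or $(s>0$ and $t>1)$ imply $(s,t)$-weak tractability. (iii) In the case $\square=\sharp$ the problem is $(s,t)$-weakly tractable if and only if $$\left(s>\tfrac{1}{\alpha}\text{ and }t>0\right)\quad\text{or}\quad\left(s>0\text{ and }t>1\right).$$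
   Context: Spaces. $\mathbb{T}^d=[0,2\pi]^d$ is the $d$-dimensional torus, and for $k\in\mathbb{Z}^d$ let $c_k(f):=(2\pi)^{-d/2}\int_{\mathbb{T}^d}f(x)\exp(-\mathrm{i}\,kx)\,\mathrm{d}x$ be the Fourier coefficients. $L_2(\mathbb{T}^d)$ is normed by $\|f\|_{L_2(\mathbb{T}^d)}=\big[\sum_{k\in\mathbb{Z}^d}|c_k(f)|^2\big]^{1/2}$. For $\alpha>0$, $H^{\alpha,\square}(\mathbb{T}^d)$ is the (isotropic, periodic) Sobolev space of all $f\in L_2(\mathbb{T}^d)$ with finite norm, where the norms are $$\|f\|_{H^{\alpha,+}(\mathbb{T}^d)}:=\Big[\sum_{k\in\mathbb{Z}^d}|c_k(f)|^2\Big(1+\sum_{j=1}^d|k_j|^2\Big)^{\alpha}\Big]^{1/2},$$ $$\|f\|_{H^{\alpha,*}(\mathbb{T}^d)}:=\Big[\sum_{k\in\mathbb{Z}^d}|c_k(f)|^2\Big(1+\sum_{j=1}^d|k_j|^{2\alpha}\Big)\Big]^{1/2},$$ $$\|f\|_{H^{\alpha,\sharp}(\mathbb{T}^d)}:=\Big[\sum_{k\in\mathbb{Z}^d}|c_k(f)|^2\Big(1+\sum_{j=1}^d|k_j|\Big)^{2\alpha}\Big]^{1/2}.$$ Information complexity. For $n\in\mathbb{N}_0$, $e^{\alpha,\square}(n,d)$ is the infimum, over all linear algorithms $A$ using at most $n$ continuous linear functionals (equivalently, linear operators of rank at most $n$), of $\sup_{\|f\|_{H^{\alpha,\square}(\mathbb{T}^d)}\le1}\|f-Af\|_{L_2(\mathbb{T}^d)}$.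 The information complexity is $n^{\alpha,\square}(\epsilon,\mathrm{id}_d):=\min\{n\in\mathbb{N}_0: e^{\alpha,\square}(n,d)\le\epsilon\}$. The initial error $e^{\alpha,\square}(0,d)$ equals $1$ for all $d$, so the absolute and normalized error criteria coincide. $(s,t)$-weak tractability. For fixed $s,t\ge0$, the problem is $(s,t)$-weakly tractable if $$\lim_{\epsilon^{-1}+d\to\infty}\frac{\ln n^{\alpha,\square}(\epsilon,\mathrm{id}_d)}{\epsilon^{-s}+d^{t}}=0,$$ where the limit is taken along all sequences $((\epsilon_k,d_k))_{k\in\mathbb{N}}\subset(0,1)\times\mathbb{N}$ with $\epsilon_k^{-1}+d_k\to\infty$. *)

theory Defs
  imports "HOL-Analysis.Analysis"
begin

text \<open>
  The dimension varies inside the statement, so points of the torus are functions on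
  \<^term>\<open>{..<d}\<close> (extended by \<^term>\<open>undefined\<close>) and the torus carries the product of the
  Lebesgue measures on the interval from 0 to 2 pi, not normalised. Functions are complex
  valued and are not identified almost everywhere; the norms below are seminorms that vanish
  exactly on the null functions, and a functional bounded by such a seminorm does not
  distinguish functions that agree almost everywhere.
\<close>

definition torus :: "nat \<Rightarrow> (nat \<Rightarrow> real) measure" where
  "torus d = PiM {..<d} (\<lambda>_. restrict_space lborel {0..2 * pi})"

definition frequencies :: "nat \<Rightarrow> (nat \<Rightarrow> int) set" where
  "frequencies d = PiE {..<d} (\<lambda>_. UNIV)"

definition L2 :: "nat \<Rightarrow> ((nat \<Rightarrow> real) \<Rightarrow> complex) set" where
  "L2 d = {f \<in> borel_measurable (torus d). integrable (torus d) (\<lambda>x. (cmod (f x))\<^sup>2)}"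

definition fourier_coeff :: "nat \<Rightarrow> ((nat \<Rightarrow> real) \<Rightarrow> complex) \<Rightarrow> (nat \<Rightarrow> int) \<Rightarrow> complex" where
  "fourier_coeff d f k =
     complex_of_real ((2 * pi) powr (- real d / 2)) *
     (\<integral>x. f x * exp (- \<i> * complex_of_real (\<Sum>j<d. real_of_int (k j) * x j)) \<partial>(torus d))"

text \<open>
  By Parseval, this is the norm given by the integral; it is meant for functions in
  \<^const>\<open>L2\<close>, for which the sum converges.
\<close>

definition L2_norm :: "nat \<Rightarrow> ((nat \<Rightarrow> real) \<Rightarrow> complex) \<Rightarrow> real" where
  "L2_norm d f = sqrt (\<Sum>\<^sub>\<infinity>k\<in>frequencies d. (cmod (fourier_coeff d f k))\<^sup>2)"

datatype norm_kind = Plus | Star | Sharp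

fun weight :: "norm_kind \<Rightarrow> real \<Rightarrow> nat \<Rightarrow> (nat \<Rightarrow> int) \<Rightarrow> real" where
  "weight Plus \<alpha> d k = (1 + (\<Sum>j<d. \<bar>real_of_int (k j)\<bar>\<^sup>2)) powr \<alpha>"
| "weight Star \<alpha> d k = 1 + (\<Sum>j<d. \<bar>real_of_int (k j)\<bar> powr (2 * \<alpha>))"
| "weight Sharp \<alpha> d k = (1 + (\<Sum>j<d. \<bar>real_of_int (k j)\<bar>)) powr (2 * \<alpha>)"

definition sobolev :: "norm_kind \<Rightarrow> real \<Rightarrow> nat \<Rightarrow> ((nat \<Rightarrow> real) \<Rightarrow> complex) set" where
  "sobolev b \<alpha> d =
     {f \<in> L2 d. (\<lambda>k. (cmod (fourier_coeff d f k))\<^sup>2 * weight b \<alpha> d k) summable_on frequencies d}"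

definition sobolev_norm :: "norm_kind \<Rightarrow> real \<Rightarrow> nat \<Rightarrow> ((nat \<Rightarrow> real) \<Rightarrow> complex) \<Rightarrow> real" where
  "sobolev_norm b \<alpha> d f =
     sqrt (\<Sum>\<^sub>\<infinity>k\<in>frequencies d. (cmod (fourier_coeff d f k))\<^sup>2 * weight b \<alpha> d k)"

definition continuous_functional ::
  "norm_kind \<Rightarrow> real \<Rightarrow> nat \<Rightarrow> (((nat \<Rightarrow> real) \<Rightarrow> complex) \<Rightarrow> complex) \<Rightarrow> bool" where
  "continuous_functional b \<alpha> d L \<longleftrightarrow>
     (\<forall>f\<in>sobolev b \<alpha> d. \<forall>g\<in>sobolev b \<alpha> d. L (\<lambda>x. f x + g x) = L f + L g) \<and>
     (\<forall>c. \<forall>f\<in>sobolev b \<alpha> d. L (\<lambda>x. c * f x) = c * L f) \<and>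
     (\<exists>C. \<forall>f\<in>sobolev b \<alpha> d. cmod (L f) \<le> C * sobolev_norm b \<alpha> d f)"

definition linear_algorithms ::
  "norm_kind \<Rightarrow> real \<Rightarrow> nat \<Rightarrow> nat \<Rightarrow>
     (((nat \<Rightarrow> real) \<Rightarrow> complex) \<Rightarrow> (nat \<Rightarrow> real) \<Rightarrow> complex) set" where
  "linear_algorithms b \<alpha> n d =
     {A. \<exists>m\<le>n. \<exists>L g. (\<forall>i<m. continuous_functional b \<alpha> d (L i)) \<and> (\<forall>i<m. g i \<in> L2 d) \<and>
           A = (\<lambda>f x. \<Sum>i<m. L i f * g i x)}"

text \<open>
  An extended nonnegative real, so that the infimum and the supremum are genuine.
\<close>

definition minimal_error :: "norm_kind \<Rightarrow> real \<Rightarrow> nat \<Rightarrow> nat \<Rightarrow> ennreal" where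
  "minimal_error b \<alpha> n d =
     (INF A\<in>linear_algorithms b \<alpha> n d.
        SUP f\<in>{f \<in> sobolev b \<alpha> d. sobolev_norm b \<alpha> d f \<le> 1}.
          ennreal (L2_norm d (\<lambda>x. f x - A f x)))"

text \<open>
  The set is nonempty for positive \<^term>\<open>\<epsilon>\<close>, because the embeddings are compact, and does not
  contain 0 for \<^term>\<open>\<epsilon> < 1\<close>, because the initial error is 1; so the logarithm below is
  never taken at 0.
\<close>

definition information_complexity :: "norm_kind \<Rightarrow> real \<Rightarrow> real \<Rightarrow> nat \<Rightarrow> nat" where
  "information_complexity b \<alpha> \<epsilon> d = (LEAST n. minimal_error b \<alpha> n d \<le> ennreal \<epsilon>)"

definition weakly_tractable :: "norm_kind \<Rightarrow> real \<Rightarrow> real \<Rightarrow> real \<Rightarrow> bool" where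
  "weakly_tractable b \<alpha> s t \<longleftrightarrow>
     (\<forall>(\<epsilon> :: nat \<Rightarrow> real) (d :: nat \<Rightarrow> nat).
        (\<forall>k. 0 < \<epsilon> k \<and> \<epsilon> k < 1 \<and> 1 \<le> d k) \<longrightarrow>
        filterlim (\<lambda>k. inverse (\<epsilon> k) + real (d k)) at_top sequentially \<longrightarrow>
        (\<lambda>k. ln (real (information_complexity b \<alpha> (\<epsilon> k) (d k)))
               / (\<epsilon> k powr (- s) + real (d k) powr t)) \<longlonglongrightarrow> 0)"

end

theory Submission
  imports Defs "HOL-Real_Asymp.Real_Asymp"
begin

text \<open>
  The Fourier characters are orthonormal, so the embedding of the Sobolev space into
  \<^const>\<open>L2\<close> is diagonal, and its singular values are the numbers
  \<open>weight b \<alpha> d k powr (- 1 / 2)\<close>. Hence the information complexity is the number of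
  frequencies \<open>k\<close> with \<open>weight b \<alpha> d k < (1 / \<epsilon>)\<^sup>2\<close>
  (\<open>information_complexity_eq_card\<close>): truncating the Fourier series to these frequencies
  reaches the error \<open>\<epsilon>\<close>, and any smaller number of functionals has a common
  zero among the nonzero trigonometric polynomials with these frequencies. From here on the
  problem is one of counting lattice points.

  Sufficiency. A counted frequency has \<open>l\<^sub>1\<close> norm at most \<open>m\<close>, the integer part of
  \<open>(1 / \<epsilon>) powr p\<close>, where \<open>p\<close> is \<open>2 / \<alpha>\<close>, \<open>max 2 (1 / \<alpha>)\<close> or \<open>1 / \<alpha>\<close> according to the
  norm. Such a lattice point is the endpoint of a walk of \<open>m\<close> steps, each of which rests
  or moves to one of the \<open>2 * d\<close> neighbours, and it lies in a cube of side length
  \<open>2 * m\<close>. So the complexity is at most \<open>(2 * d + 1) ^ m\<close> and at most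
  \<open>(2 * m + 1) ^ d\<close> (\<open>ln_information_complexity_le\<close>); its logarithm is, up to a
  logarithmic factor, at most \<open>(1 / \<epsilon>) powr p\<close> and at most \<open>d\<close>. The first bound
  is negligible against \<open>\<epsilon> powr (- s) + d powr t\<close> if \<open>s > p\<close>
  and \<open>t > 0\<close>, the second if \<open>s > 0\<close> and \<open>t > 1\<close>.

  Necessity. A vector with entries 0 and 1, at most \<open>e\<close> of them 1, has weight at most
  \<open>(1 + e) powr (2 / q)\<close>, where \<open>q\<close> is \<open>2 / \<alpha>\<close>, \<open>2\<close> or \<open>1 / \<alpha>\<close>. So the
  complexity is at least \<open>2 ^ e\<close> if \<open>\<epsilon> \<le> (2 + e) powr (- 1 / q)\<close>
  (\<open>information_complexity_ge_cube\<close>). With \<open>e = d\<close> and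
  \<open>\<epsilon> = (2 + d) powr (- 1 / q)\<close> this refutes tractability for \<open>s \<le> q\<close> and \<open>t \<le> 1\<close>; with
  \<open>e = 1\<close> it excludes \<open>s = 0\<close> and \<open>t = 0\<close>. For the norms \<^const>\<open>Plus\<close> and
  \<^const>\<open>Sharp\<close> the exponents \<open>p\<close> and \<open>q\<close> agree; for \<^const>\<open>Star\<close> they
  differ if \<open>\<alpha> < 1 / 2\<close>.
\<close>

section \<open>Fourier coefficients on the torus\<close>

abbreviation circle :: "real measure" where
  "circle \<equiv> restrict_space lborel {0..2 * pi}"

lemma finite_measure_circle: "finite_measure circle"
  by (rule finite_measureI) (simp add: emeasure_restrict_space)

interpretation circles: product_sigma_finite "\<lambda>_ :: nat. circle"
proof -
  interpret finite_measure circle by (rule finite_measure_circle)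
  show "product_sigma_finite (\<lambda>_ :: nat. circle)" by unfold_locales
qed

lemma finite_measure_torus: "finite_measure (torus d)"
proof -
  interpret finite_measure circle by (rule finite_measure_circle)
  interpret finite_product_sigma_finite "\<lambda>_ :: nat. circle" "{..<d}" by unfold_locales simp
  have "emeasure (torus d) (space (torus d)) = (\<Prod>j<d. emeasure circle (space circle))"
    unfolding torus_def space_PiM by (subst measure_times) (auto simp: sets_restrict_space)
  also have "\<dots> \<noteq> \<infinity>"
    by (simp add: emeasure_eq_measure ennreal_power)
  finally show ?thesis by (rule finite_measureI)
qed

lemma circle_character_integral:
  fixes n :: int
  shows "integrable circle (\<lambda>x. exp (\<i> * of_real (of_int n * x)))"
    and "(\<integral>x. exp (\<i> * of_real (of_int n * x)) \<partial>circle) = (if n = 0 then of_real (2 * pi) else 0)"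
proof -
  let ?f = "\<lambda>x :: real. exp (\<i> * of_real (of_int n * x))"
  have cont: "continuous_on {0..2 * pi} ?f"
    by (intro continuous_intros)
  define F :: "real \<Rightarrow> complex" where
    "F x = (if n = 0 then of_real x else exp (\<i> * of_real (of_int n * x)) / (\<i> * of_int n))" for x
  have "(F has_vector_derivative ?f x) (at x within {0..2 * pi})" for x
  proof (cases "n = 0")
    case True
    then show ?thesis
      unfolding F_def by (auto intro!: derivative_eq_intros)
  next
    case False
    have "((\<lambda>z. exp (\<i> * (of_int n * z)) / (\<i> * of_int n)) has_field_derivative
            exp (\<i> * (of_int n * of_real x))) (at (of_real x))"
      using False by (auto intro!: derivative_eq_intros simp: field_simps)
    then have "((\<lambda>z. exp (\<i> * (of_int n * of_real z)) / (\<i> * of_int n)) has_vector_derivative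
            exp (\<i> * (of_int n * of_real x))) (at x within {0..2 * pi})"
      by (rule has_vector_derivative_real_field)
    with False show ?thesis
      unfolding F_def by simp
  qed
  then have ftc: "has_bochner_integral lborel (\<lambda>x. indicator {0..2 * pi} x *\<^sub>R ?f x) (F (2 * pi) - F 0)"
    by (intro has_bochner_integral_FTC_Icc cont) auto
  then show "integrable circle ?f"
    by (auto simp: integrable_restrict_space has_bochner_integral_iff)
  have "exp (\<i> * of_real (of_int n * (2 * pi))) = 1"
    by (simp add: exp_eq_1)
  then have "F (2 * pi) - F 0 = (if n = 0 then of_real (2 * pi) else 0)"
    unfolding F_def by auto
  then show "(\<integral>x. ?f x \<partial>circle) = (if n = 0 then of_real (2 * pi) else 0)"
    using has_bochner_integral_integral_eq[OF ftc] by (subst integral_restrict_space) auto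
qed

definition character :: "nat \<Rightarrow> (nat \<Rightarrow> int) \<Rightarrow> (nat \<Rightarrow> real) \<Rightarrow> complex" where
  "character d k x =
     of_real ((2 * pi) powr (- real d / 2)) * exp (\<i> * of_real (\<Sum>j<d. of_int (k j) * x j))"

lemma torus_coordinate_measurable [measurable]:
  "j < d \<Longrightarrow> (\<lambda>x. x j) \<in> borel_measurable (torus d)"
  unfolding torus_def
  by (rule measurable_PiM_component_rev) (auto intro: measurable_restrict_space1)

lemma torus_phase_measurable [measurable]:
  "(\<lambda>x. \<Sum>j<d. of_int (k j) * x j) \<in> borel_measurable (torus d)"
  by (intro borel_measurable_sum borel_measurable_times torus_coordinate_measurable) auto

lemma character_measurable [measurable]: "character d k \<in> borel_measurable (torus d)"
  unfolding character_def[abs_def] by measurable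

lemma character_in_L2: "character d k \<in> L2 d"
proof -
  interpret finite_measure "torus d" by (rule finite_measure_torus)
  have "integrable (torus d) (\<lambda>x. (cmod (character d k x))\<^sup>2)"
    by (rule integrable_const_bound[where B = "((2 * pi) powr (- real d / 2))\<^sup>2"])
      (auto simp: character_def norm_mult)
  then show ?thesis by (simp add: L2_def)
qed

lemma L2_add:
  assumes "f \<in> L2 d" "g \<in> L2 d"
  shows "(\<lambda>x. f x + g x) \<in> L2 d"
proof -
  have [measurable]: "f \<in> borel_measurable (torus d)" "g \<in> borel_measurable (torus d)"
    and int: "integrable (torus d) (\<lambda>x. (cmod (f x))\<^sup>2)" "integrable (torus d) (\<lambda>x. (cmod (g x))\<^sup>2)"
    using assms by (auto simp: L2_def)
  have "(cmod (u + v))\<^sup>2 \<le> 2 * (cmod u)\<^sup>2 + 2 * (cmod v)\<^sup>2" for u v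
  proof -
    have "(cmod (u + v))\<^sup>2 \<le> (cmod u + cmod v)\<^sup>2"
      by (intro power_mono norm_triangle_ineq) auto
    also have "\<dots> \<le> 2 * (cmod u)\<^sup>2 + 2 * (cmod v)\<^sup>2"
      using zero_le_power2[of "cmod u - cmod v"] by (simp add: power2_eq_square algebra_simps)
    finally show ?thesis .
  qed
  then have "integrable (torus d) (\<lambda>x. (cmod (f x + g x))\<^sup>2)"
    by (intro Bochner_Integration.integrable_bound[OF Bochner_Integration.integrable_add[OF
          integrable_mult_right[OF int(1), of 2] integrable_mult_right[OF int(2), of 2]]]) auto
  then show ?thesis by (simp add: L2_def)
qed

lemma L2_scale: "f \<in> L2 d \<Longrightarrow> (\<lambda>x. c * f x) \<in> L2 d"
  by (auto simp: L2_def norm_mult power_mult_distrib)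

text \<open>
  Additivity of the Fourier coefficients rests on this: on a set of finite measure a square
  integrable function is integrable, because \<open>u \<le> 1 + u\<^sup>2\<close>.
\<close>

lemma L2_times_wave_integrable:
  assumes "f \<in> L2 d"
  shows "integrable (torus d)
           (\<lambda>x. f x * exp (- \<i> * complex_of_real (\<Sum>j<d. real_of_int (k j) * x j)))"
proof -
  interpret finite_measure "torus d" by (rule finite_measure_torus)
  have [measurable]: "f \<in> borel_measurable (torus d)"
    and int: "integrable (torus d) (\<lambda>x. (cmod (f x))\<^sup>2)"
    using assms by (auto simp: L2_def)
  have "u \<le> 1 + u\<^sup>2" for u :: real
  proof -
    have "2 * u \<le> 1 + u\<^sup>2"
      using zero_le_power2[of "u - 1"] by (simp add: power2_diff)
    then show ?thesis using zero_le_power2[of u] by linarith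
  qed
  then show ?thesis
    by (intro Bochner_Integration.integrable_bound[OF Bochner_Integration.integrable_add[OF
          integrable_const[of "1 :: real"] int]]) (auto simp: norm_mult)
qed

lemma fourier_coeff_add:
  assumes "f \<in> L2 d" "g \<in> L2 d"
  shows "fourier_coeff d (\<lambda>x. f x + g x) k = fourier_coeff d f k + fourier_coeff d g k"
  using L2_times_wave_integrable[OF assms(1), of k] L2_times_wave_integrable[OF assms(2), of k]
  unfolding fourier_coeff_def distrib_right
  by (subst Bochner_Integration.integral_add) (auto simp: algebra_simps)

lemma fourier_coeff_scale: "fourier_coeff d (\<lambda>x. c * f x) k = c * fourier_coeff d f k"
  unfolding fourier_coeff_def by (simp add: mult.assoc mult.left_commute)

text \<open>
  Orthonormality: the integral over the torus factorises over the coordinates, and two distinct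
  frequencies differ in a coordinate below \<open>d\<close>, since both are extensional.
\<close>

lemma fourier_coeff_character:
  assumes "k \<in> frequencies d" "l \<in> frequencies d"
  shows "fourier_coeff d (character d l) k = (if k = l then 1 else 0)"
proof -
  let ?c = "complex_of_real ((2 * pi) powr (- real d / 2))"
  have c: "?c * ?c * of_real (2 * pi) ^ d = 1"
  proof -
    have "(2 * pi) powr (- real d / 2) * (2 * pi) powr (- real d / 2) * (2 * pi) ^ d = 1"
      by (subst powr_realpow[symmetric], simp, unfold powr_add[symmetric]) simp
    then show ?thesis by (metis of_real_1 of_real_mult of_real_power)
  qed
  have "character d l x * exp (- \<i> * complex_of_real (\<Sum>j<d. real_of_int (k j) * x j))
      = ?c * (\<Prod>j<d. exp (\<i> * of_real (of_int (l j - k j) * x j)))" for x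
  proof -
    have "\<i> * complex_of_real (\<Sum>j<d. real_of_int (l j) * x j)
          + - \<i> * complex_of_real (\<Sum>j<d. real_of_int (k j) * x j)
        = (\<Sum>j<d. \<i> * of_real (of_int (l j - k j) * x j))"
      by (simp add: sum_distrib_left algebra_simps sum_subtractf sum_negf)
    then show ?thesis
      unfolding character_def by (simp add: exp_add[symmetric] exp_sum mult.assoc)
  qed
  then have "fourier_coeff d (character d l) k
      = ?c * ?c * (\<integral>x. (\<Prod>j<d. exp (\<i> * of_real (of_int (l j - k j) * x j))) \<partial>torus d)"
    unfolding fourier_coeff_def by simp
  also have "(\<integral>x. (\<Prod>j<d. exp (\<i> * of_real (of_int (l j - k j) * x j))) \<partial>torus d)
      = (\<Prod>j<d. \<integral>x. exp (\<i> * of_real (of_int (l j - k j) * x)) \<partial>circle)"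
    unfolding torus_def
    by (rule circles.product_integral_prod) (auto intro: circle_character_integral simp del: of_int_diff of_real_mult)
  also have "\<dots> = (\<Prod>j<d. if l j = k j then of_real (2 * pi) else 0)"
    by (subst circle_character_integral) auto
  also have "\<dots> = (if k = l then of_real (2 * pi) ^ d else 0)"
  proof (cases "k = l")
    case False
    then obtain j where "j < d" "k j \<noteq> l j"
      using assms unfolding frequencies_def by (metis PiE_ext lessThan_iff)
    with False show ?thesis
      by (auto intro!: prod_zero)
  qed simp
  finally show ?thesis using c by simp
qed

text \<open>
  Trigonometric polynomials serve twice: as the truncated Fourier series of an optimal algorithm,
  and as the functions on which an algorithm of too small rank is blind.
\<close>

definition trig_poly ::
  "nat \<Rightarrow> (nat \<Rightarrow> int) set \<Rightarrow> ((nat \<Rightarrow> int) \<Rightarrow> complex) \<Rightarrow> (nat \<Rightarrow> real) \<Rightarrow> complex" where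
  "trig_poly d S a = (\<lambda>x. \<Sum>k\<in>S. a k * character d k x)"

lemma trig_poly_insert:
  "finite S \<Longrightarrow> l \<notin> S \<Longrightarrow>
     trig_poly d (insert l S) a = (\<lambda>x. a l * character d l x + trig_poly d S a x)"
  by (simp add: trig_poly_def)

lemma trig_poly_in_L2: "finite S \<Longrightarrow> trig_poly d S a \<in> L2 d"
proof (induction S rule: finite_induct)
  case empty
  show ?case by (simp add: trig_poly_def L2_def)
next
  case (insert l S)
  then show ?case
    by (simp add: trig_poly_insert L2_add L2_scale character_in_L2)
qed

lemma fourier_coeff_trig_poly:
  assumes "finite S" "S \<subseteq> frequencies d" "k \<in> frequencies d"
  shows "fourier_coeff d (trig_poly d S a) k = (if k \<in> S then a k else 0)"
  using assms(1,2)
proof (induction S rule: finite_induct)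
  case empty
  show ?case by (simp add: trig_poly_def fourier_coeff_def)
next
  case (insert l S)
  then show ?case
    using assms(3)
    by (auto simp: trig_poly_insert fourier_coeff_add fourier_coeff_scale fourier_coeff_character
        L2_scale character_in_L2 trig_poly_in_L2)
qed

section \<open>Sobolev spaces\<close>

lemma weight_ge_1: "\<alpha> > 0 \<Longrightarrow> 1 \<le> weight b \<alpha> d k"
  by (cases b) (auto intro!: ge_one_powr_ge_zero sum_nonneg)

lemma sobolev_imp_L2: "f \<in> sobolev b \<alpha> d \<Longrightarrow> f \<in> L2 d"
  by (simp add: sobolev_def)

text \<open>
  Since the weights are at least 1, Fourier coefficients are continuous functionals on the Sobolev
  space.
\<close>

lemma sobolev_norm_ge_coeff:
  assumes "\<alpha> > 0" "f \<in> sobolev b \<alpha> d" "k \<in> frequencies d"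
  shows "cmod (fourier_coeff d f k) \<le> sobolev_norm b \<alpha> d f"
proof -
  let ?t = "\<lambda>k. (cmod (fourier_coeff d f k))\<^sup>2 * weight b \<alpha> d k"
  have w: "1 \<le> weight b \<alpha> d k" for k
    using assms(1) by (rule weight_ge_1)
  have "(cmod (fourier_coeff d f k))\<^sup>2 \<le> ?t k"
    using w[of k] by (simp add: mult_le_cancel_left1)
  also have "\<dots> = (\<Sum>\<^sub>\<infinity>k\<in>{k}. ?t k)" by simp
  also have "\<dots> \<le> (\<Sum>\<^sub>\<infinity>k\<in>frequencies d. ?t k)"
    using assms w order_trans[OF zero_le_one w]
    by (intro infsum_mono_neutral) (auto simp: sobolev_def)
  finally show ?thesis
    unfolding sobolev_norm_def by (intro real_le_rsqrt)
qed

lemma trig_poly_in_sobolev: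
  assumes "finite S" "S \<subseteq> frequencies d"
  shows "trig_poly d S a \<in> sobolev b \<alpha> d"
    and "sobolev_norm b \<alpha> d (trig_poly d S a) = sqrt (\<Sum>k\<in>S. (cmod (a k))\<^sup>2 * weight b \<alpha> d k)"
    and "L2_norm d (trig_poly d S a) = sqrt (\<Sum>k\<in>S. (cmod (a k))\<^sup>2)"
proof -
  let ?c = "fourier_coeff d (trig_poly d S a)"
  have c: "?c k = (if k \<in> S then a k else 0)" if "k \<in> frequencies d" for k
    using assms that by (rule fourier_coeff_trig_poly)
  have "(\<lambda>k. (cmod (?c k))\<^sup>2 * weight b \<alpha> d k) summable_on frequencies d \<longleftrightarrow>
      (\<lambda>k. (cmod (?c k))\<^sup>2 * weight b \<alpha> d k) summable_on S"
    using assms c by (intro summable_on_cong_neutral) auto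
  then show "trig_poly d S a \<in> sobolev b \<alpha> d"
    using assms(1) by (simp add: sobolev_def trig_poly_in_L2)
  have "(\<Sum>\<^sub>\<infinity>k\<in>frequencies d. (cmod (?c k))\<^sup>2 * w k) = (\<Sum>k\<in>S. (cmod (a k))\<^sup>2 * w k)"
    for w :: "(nat \<Rightarrow> int) \<Rightarrow> real"
  proof -
    have "(\<Sum>\<^sub>\<infinity>k\<in>frequencies d. (cmod (?c k))\<^sup>2 * w k) = (\<Sum>\<^sub>\<infinity>k\<in>S. (cmod (a k))\<^sup>2 * w k)"
      using assms c by (intro infsum_cong_neutral) (auto simp: subset_eq)
    then show ?thesis using assms(1) by simp
  qed
  from this[of "weight b \<alpha> d"] this[of "\<lambda>_. 1"]
  show "sobolev_norm b \<alpha> d (trig_poly d S a) = sqrt (\<Sum>k\<in>S. (cmod (a k))\<^sup>2 * weight b \<alpha> d k)"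
    and "L2_norm d (trig_poly d S a) = sqrt (\<Sum>k\<in>S. (cmod (a k))\<^sup>2)"
    unfolding sobolev_norm_def L2_norm_def by auto
qed

text \<open>
  Linearity of a continuous functional is only available inside the Sobolev space, so the
  induction has to check that every partial sum lies in it.
\<close>

lemma continuous_functional_trig_poly:
  assumes L: "continuous_functional b \<alpha> d L" and "finite S" "S \<subseteq> frequencies d"
  shows "L (trig_poly d S a) = (\<Sum>k\<in>S. a k * L (character d k))"
  using assms(2,3)
proof (induction S rule: finite_induct)
  case empty
  have "L (\<lambda>x. 0 * trig_poly d {} a x) = 0 * L (trig_poly d {} a)"
    using L trig_poly_in_sobolev(1)[of "{}" d a b \<alpha>] unfolding continuous_functional_def by blast
  then show ?case by (simp add: trig_poly_def)
next
  case (insert l S)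
  have eq: "trig_poly d {l} u = (\<lambda>x. u l * character d l x)" for u
    by (simp add: trig_poly_def)
  have "character d l \<in> sobolev b \<alpha> d" "(\<lambda>x. a l * character d l x) \<in> sobolev b \<alpha> d"
    using trig_poly_in_sobolev(1)[of "{l}" d "\<lambda>_. 1" b \<alpha>] trig_poly_in_sobolev(1)[of "{l}" d a b \<alpha>] insert
    unfolding eq by auto
  moreover have "trig_poly d S a \<in> sobolev b \<alpha> d"
    using insert by (intro trig_poly_in_sobolev) auto
  ultimately show ?case
    using L insert by (simp add: trig_poly_insert continuous_functional_def)
qed

section \<open>Information complexity as a count of frequencies\<close>

text \<open>
  Gaussian elimination on the number of equations: an equation with a nonzero coefficient at
  \<open>p\<close> is used to eliminate the unknown \<open>p\<close>.
\<close>

lemma homogeneous_system_nontrivial_solution: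
  fixes M :: "nat \<Rightarrow> 'a \<Rightarrow> 'b :: field"
  assumes "finite S" "m < card S"
  obtains a where "\<exists>k\<in>S. a k \<noteq> 0" "\<And>i. i < m \<Longrightarrow> (\<Sum>k\<in>S. a k * M i k) = 0"
  using assms
proof (induction m arbitrary: S M thesis)
  case 0
  then obtain k where "k \<in> S" by fastforce
  then show ?case by (intro 0(1)[of "\<lambda>_. 1"]) auto
next
  case (Suc m)
  show ?case
  proof (cases "\<forall>k\<in>S. M m k = 0")
    case True
    obtain a where a: "\<exists>k\<in>S. a k \<noteq> 0" "\<And>i. i < m \<Longrightarrow> (\<Sum>k\<in>S. a k * M i k) = 0"
      using Suc.IH[of S M] Suc.prems by auto
    have "(\<Sum>k\<in>S. a k * M i k) = 0" if "i < Suc m" for i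
      using a(2) True that by (cases "i = m") auto
    then show ?thesis using a(1) Suc.prems(1) by blast
  next
    case False
    then obtain p where p: "p \<in> S" "M m p \<noteq> 0" by blast
    let ?S = "S - {p}"
    define M' where "M' i k = M i k - M i p * M m k / M m p" for i k
    have "m < card ?S" using Suc.prems p by simp
    then obtain a where a: "\<exists>k\<in>?S. a k \<noteq> 0" "\<And>i. i < m \<Longrightarrow> (\<Sum>k\<in>?S. a k * M' i k) = 0"
      using Suc.IH[of ?S M'] Suc.prems by auto
    \<comment> \<open>the value of the eliminated unknown that solves the last equation\<close>
    define c where "c = - (\<Sum>k\<in>?S. a k * M m k) / M m p"
    have split: "(\<Sum>k\<in>S. (a(p := c)) k * M i k) = c * M i p + (\<Sum>k\<in>?S. a k * M i k)" for i
      using Suc.prems p by (subst sum.remove[of S p]) auto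
    have "(\<Sum>k\<in>S. (a(p := c)) k * M i k) = 0" if "i < Suc m" for i
    proof (cases "i = m")
      case True
      then show ?thesis unfolding split unfolding c_def using p True by simp
    next
      case False
      then have "0 = (\<Sum>k\<in>?S. a k * M' i k)"
        using a that by simp
      also have "\<dots> = (\<Sum>k\<in>?S. a k * M i k) - M i p * (\<Sum>k\<in>?S. a k * M m k) / M m p"
        unfolding M'_def sum_divide_distrib sum_distrib_left sum_subtractf[symmetric]
        by (intro sum.cong) (auto simp: algebra_simps)
      also have "\<dots> = c * M i p + (\<Sum>k\<in>?S. a k * M i k)"
        by (simp add: c_def)
      finally show ?thesis unfolding split by simp
    qed
    moreover have "\<exists>k\<in>S. (a(p := c)) k \<noteq> 0"
      using a(1) by auto
    ultimately show ?thesis using Suc.prems(1) by blast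
  qed
qed

lemma continuous_functional_fourier_coeff:
  assumes "\<alpha> > 0" "k \<in> frequencies d"
  shows "continuous_functional b \<alpha> d (\<lambda>f. fourier_coeff d f k)"
  unfolding continuous_functional_def
  using assms by (auto simp: fourier_coeff_add fourier_coeff_scale sobolev_imp_L2
      intro!: exI[of _ 1] sobolev_norm_ge_coeff)

definition small_weights :: "norm_kind \<Rightarrow> real \<Rightarrow> real \<Rightarrow> nat \<Rightarrow> (nat \<Rightarrow> int) set" where
  "small_weights b \<alpha> \<epsilon> d = {k \<in> frequencies d. weight b \<alpha> d k < (1 / \<epsilon>)\<^sup>2}"

text \<open>
  The remainder has only Fourier coefficients whose weight is at least \<open>(1 / \<epsilon>)\<^sup>2\<close>, so its
  squared norm is at most \<open>\<epsilon>\<^sup>2\<close> times the squared Sobolev norm of \<open>f\<close>.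
\<close>

lemma truncation_error:
  assumes "\<alpha> > 0" "\<epsilon> > 0" and fin: "finite (small_weights b \<alpha> \<epsilon> d)"
    and f: "f \<in> sobolev b \<alpha> d" "sobolev_norm b \<alpha> d f \<le> 1"
  shows "L2_norm d (\<lambda>x. f x - trig_poly d (small_weights b \<alpha> \<epsilon> d) (fourier_coeff d f) x) \<le> \<epsilon>"
proof -
  let ?S = "small_weights b \<alpha> \<epsilon> d"
  let ?c = "fourier_coeff d f"
  let ?t = "\<lambda>k. (cmod (?c k))\<^sup>2 * weight b \<alpha> d k"
  let ?r = "\<lambda>x. f x - trig_poly d ?S ?c x"
  have sub: "?S \<subseteq> frequencies d" by (auto simp: small_weights_def)
  have r: "?r = (\<lambda>x. f x + (- 1) * trig_poly d ?S ?c x)" by auto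
  have c: "fourier_coeff d ?r k = (if k \<in> ?S then 0 else ?c k)" if "k \<in> frequencies d" for k
    unfolding r using that fin sub f
    by (subst fourier_coeff_add, simp_all only: fourier_coeff_scale)
      (auto simp: fourier_coeff_trig_poly intro: sobolev_imp_L2 L2_scale[of _ _ "- 1", simplified] trig_poly_in_L2)
  have bound: "(cmod (fourier_coeff d ?r k))\<^sup>2 \<le> \<epsilon>\<^sup>2 * ?t k" if "k \<in> frequencies d" for k
  proof (cases "k \<in> ?S")
    case True
    then show ?thesis
      using c[OF that] weight_ge_1[OF assms(1), of b d k] by simp
  next
    case False
    then have "(1 / \<epsilon>)\<^sup>2 \<le> weight b \<alpha> d k"
      using that by (simp add: small_weights_def)
    then have "1 \<le> \<epsilon>\<^sup>2 * weight b \<alpha> d k"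
      using \<open>\<epsilon> > 0\<close> by (simp add: field_simps)
    then have "(cmod (?c k))\<^sup>2 * 1 \<le> (cmod (?c k))\<^sup>2 * (\<epsilon>\<^sup>2 * weight b \<alpha> d k)"
      by (intro mult_left_mono) auto
    then show ?thesis using c[OF that] False by (simp add: mult_ac)
  qed
  have t: "?t summable_on frequencies d"
    using f by (simp add: sobolev_def)
  have tpos: "0 \<le> ?t k" for k
    using weight_ge_1[OF assms(1), of b d k] by simp
  have "(\<Sum>\<^sub>\<infinity>k\<in>frequencies d. ?t k) \<le> 1"
    using f(2) tpos by (simp add: sobolev_norm_def infsum_nonneg)
  moreover have "(\<Sum>\<^sub>\<infinity>k\<in>frequencies d. (cmod (fourier_coeff d ?r k))\<^sup>2)
      \<le> (\<Sum>\<^sub>\<infinity>k\<in>frequencies d. \<epsilon>\<^sup>2 * ?t k)"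
    using bound tpos summable_on_cmult_right[OF t, of "\<epsilon>\<^sup>2"]
    by (intro infsum_mono summable_on_comparison_test[OF summable_on_cmult_right[OF t, of "\<epsilon>\<^sup>2"]]) auto
  ultimately have "(\<Sum>\<^sub>\<infinity>k\<in>frequencies d. (cmod (fourier_coeff d ?r k))\<^sup>2) \<le> \<epsilon>\<^sup>2"
    using t by (simp add: infsum_cmult_right) (smt (verit) mult_left_le zero_le_power2)
  then show ?thesis
    unfolding L2_norm_def using \<open>\<epsilon> > 0\<close> by (intro real_le_lsqrt) auto
qed

lemma minimal_error_le:
  assumes "\<alpha> > 0" "\<epsilon> > 0" and fin: "finite (small_weights b \<alpha> \<epsilon> d)"
  shows "minimal_error b \<alpha> (card (small_weights b \<alpha> \<epsilon> d)) d \<le> ennreal \<epsilon>"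
proof -
  let ?S = "small_weights b \<alpha> \<epsilon> d"
  obtain h where h: "bij_betw h {..<card ?S} ?S"
    using ex_bij_betw_nat_finite[OF fin] by (auto simp: atLeast0LessThan)
  have mem: "h i \<in> frequencies d" if "i < card ?S" for i
    using h that by (auto simp: bij_betw_def small_weights_def)
  define A where "A f = trig_poly d ?S (fourier_coeff d f)" for f
  have "A = (\<lambda>f x. \<Sum>i<card ?S. fourier_coeff d f (h i) * character d (h i) x)"
    unfolding A_def trig_poly_def by (intro ext sum.reindex_bij_betw[OF h, symmetric])
  then have "A \<in> linear_algorithms b \<alpha> (card ?S) d"
    unfolding linear_algorithms_def using assms(1) mem
    by (intro CollectI exI[of _ "card ?S"] conjI exI[of _ "\<lambda>i f. fourier_coeff d f (h i)"]
        exI[of _ "\<lambda>i. character d (h i)"]) (auto simp: continuous_functional_fourier_coeff character_in_L2)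
  then have "minimal_error b \<alpha> (card ?S) d
      \<le> (SUP f\<in>{f \<in> sobolev b \<alpha> d. sobolev_norm b \<alpha> d f \<le> 1}. ennreal (L2_norm d (\<lambda>x. f x - A f x)))"
    unfolding minimal_error_def by (rule INF_lower)
  also have "\<dots> \<le> ennreal \<epsilon>"
    using assms unfolding A_def by (intro SUP_least ennreal_leI truncation_error) auto
  finally show ?thesis .
qed

text \<open>
  Fewer than \<open>card S\<close> functionals have a common zero among the nonzero trigonometric polynomials
  with frequencies in \<open>S\<close>. There the algorithm returns 0, and the error relative to the
  Sobolev norm is at least \<open>1 / sqrt W\<close>.
\<close>

lemma minimal_error_ge:
  assumes "\<alpha> > 0" "finite S" "S \<subseteq> frequencies d" "n < card S"
    and w: "\<And>k. k \<in> S \<Longrightarrow> weight b \<alpha> d k \<le> W"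
  shows "ennreal (1 / sqrt W) \<le> minimal_error b \<alpha> n d"
  unfolding minimal_error_def
proof (rule INF_greatest)
  fix A assume "A \<in> linear_algorithms b \<alpha> n d"
  then obtain m L g where m: "m \<le> n" and L: "\<And>i. i < m \<Longrightarrow> continuous_functional b \<alpha> d (L i)"
    and A: "A = (\<lambda>f x. \<Sum>i<m. L i f * g i x)"
    unfolding linear_algorithms_def by blast
  obtain a where a: "\<exists>k\<in>S. a k \<noteq> 0"
    and La: "\<And>i. i < m \<Longrightarrow> (\<Sum>k\<in>S. a k * L i (character d k)) = 0"
    using homogeneous_system_nontrivial_solution[of S m "\<lambda>i k. L i (character d k)"] assms m
    by (metis le_less_trans)
  define N where "N = (\<Sum>k\<in>S. (cmod (a k))\<^sup>2 * weight b \<alpha> d k)"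
  define Q where "Q = (\<Sum>k\<in>S. (cmod (a k))\<^sup>2)"
  have w1: "1 \<le> weight b \<alpha> d k" for k using assms(1) by (rule weight_ge_1)
  have "Q > 0"
    unfolding Q_def using a assms(2) by (auto intro!: sum_pos2)
  moreover have "Q \<le> N"
    unfolding Q_def N_def using w1 by (intro sum_mono) (simp add: mult_le_cancel_left1)
  ultimately have N: "N > 0" by simp
  have NQ: "N \<le> W * Q"
    unfolding N_def Q_def sum_distrib_left using w
    by (intro sum_mono) (auto simp: mult.commute intro: mult_right_mono)
  with N \<open>Q > 0\<close> have W: "W > 0"
    by (metis less_le_trans zero_less_mult_pos2)
  let ?a = "\<lambda>k. of_real (1 / sqrt N) * a k"
  let ?f = "trig_poly d S ?a"
  have norm_a: "(cmod (?a k))\<^sup>2 = (cmod (a k))\<^sup>2 / N" for k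
    using N by (simp add: norm_mult norm_divide power_divide)
  have "(\<Sum>k\<in>S. (cmod (?a k))\<^sup>2 * weight b \<alpha> d k) = N / N"
    by (simp only: norm_a times_divide_eq_left sum_divide_distrib[symmetric] N_def[symmetric])
  moreover have "(\<Sum>k\<in>S. (cmod (?a k))\<^sup>2) = Q / N"
    by (simp only: norm_a sum_divide_distrib[symmetric] Q_def[symmetric])
  ultimately have f: "?f \<in> sobolev b \<alpha> d" "sobolev_norm b \<alpha> d ?f = sqrt (N / N)"
      "L2_norm d ?f = sqrt (Q / N)"
    using trig_poly_in_sobolev[OF assms(2,3)] by simp_all
  have "L i ?f = 0" if "i < m" for i
  proof -
    have "L i ?f = of_real (1 / sqrt N) * (\<Sum>k\<in>S. a k * L i (character d k))"
      unfolding sum_distrib_left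
      by (subst continuous_functional_trig_poly[OF L[OF that] assms(2,3)]) (simp add: mult.assoc)
    then show ?thesis using La[OF that] by simp
  qed
  then have Af: "(\<lambda>x. ?f x - A ?f x) = ?f"
    unfolding A by simp
  have "1 / W \<le> Q / N"
    using NQ N W by (simp add: field_simps)
  then have "sqrt (1 / W) \<le> sqrt (Q / N)"
    by (rule real_sqrt_le_mono)
  then have "1 / sqrt W \<le> L2_norm d (\<lambda>x. ?f x - A ?f x)"
    unfolding Af f(3) by (simp only: real_sqrt_divide real_sqrt_one)
  then have "ennreal (1 / sqrt W) \<le> ennreal (L2_norm d (\<lambda>x. ?f x - A ?f x))"
    by (rule ennreal_leI)
  also have "\<dots> \<le> (SUP f\<in>{f \<in> sobolev b \<alpha> d. sobolev_norm b \<alpha> d f \<le> 1}.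
      ennreal (L2_norm d (\<lambda>x. f x - A f x)))"
    using f N by (intro SUP_upper) auto
  finally show "ennreal (1 / sqrt W) \<le> \<dots>" .
qed

theorem information_complexity_eq_card:
  assumes "\<alpha> > 0" "\<epsilon> > 0" and fin: "finite (small_weights b \<alpha> \<epsilon> d)"
  shows "information_complexity b \<alpha> \<epsilon> d = card (small_weights b \<alpha> \<epsilon> d)"
  unfolding information_complexity_def
proof (rule Least_equality)
  let ?S = "small_weights b \<alpha> \<epsilon> d"
  show "minimal_error b \<alpha> (card ?S) d \<le> ennreal \<epsilon>"
    using assms by (rule minimal_error_le)
  fix n assume n: "minimal_error b \<alpha> n d \<le> ennreal \<epsilon>"
  show "card ?S \<le> n"
  proof (rule ccontr)
    assume "\<not> card ?S \<le> n"
    then have less: "n < card ?S" by simp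
    \<comment> \<open>the maximum, not \<open>(1 / \<epsilon>)\<^sup>2\<close>: the lower bound for the error must exceed \<open>\<epsilon>\<close> strictly\<close>
    define W where "W = Max (weight b \<alpha> d ` ?S)"
    have ne: "?S \<noteq> {}" using less by auto
    have W: "weight b \<alpha> d k \<le> W" if "k \<in> ?S" for k
      unfolding W_def using that fin by auto
    have "W \<in> weight b \<alpha> d ` ?S"
      unfolding W_def using fin ne by (intro Max_in) auto
    then have W_less: "W < (1 / \<epsilon>)\<^sup>2" and "1 \<le> W"
      using weight_ge_1[OF assms(1)] by (auto simp: small_weights_def)
    have "sqrt W < 1 / \<epsilon>"
      using W_less \<open>\<epsilon> > 0\<close> by (intro real_less_lsqrt) auto
    with \<open>1 \<le> W\<close> \<open>\<epsilon> > 0\<close> have "\<epsilon> < 1 / sqrt W"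
      by (simp add: field_simps)
    moreover have "ennreal (1 / sqrt W) \<le> ennreal \<epsilon>"
      using minimal_error_ge[OF assms(1) fin _ less W] n
      by (auto simp: small_weights_def intro: order_trans)
    ultimately show False
      using \<open>\<epsilon> > 0\<close> by (simp add: ennreal_le_iff)
  qed
qed

section \<open>Counting frequencies\<close>

definition l1_ball :: "nat \<Rightarrow> nat \<Rightarrow> (nat \<Rightarrow> int) set" where
  "l1_ball d m = {k \<in> frequencies d. (\<Sum>j<d. \<bar>k j\<bar>) \<le> int m}"

lemma l1_ball_subset_box: "l1_ball d m \<subseteq> PiE {..<d} (\<lambda>_. {- int m..int m})"
proof
  fix k assume k: "k \<in> l1_ball d m"
  have "\<bar>k j\<bar> \<le> int m" if "j < d" for j
  proof -
    have "\<bar>k j\<bar> \<le> (\<Sum>j<d. \<bar>k j\<bar>)"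
      using that by (intro member_le_sum) auto
    then show ?thesis using k by (simp add: l1_ball_def)
  qed
  then show "k \<in> PiE {..<d} (\<lambda>_. {- int m..int m})"
    using k by (force simp: l1_ball_def frequencies_def PiE_iff abs_le_iff)
qed

lemma finite_l1_ball: "finite (l1_ball d m)"
  by (rule finite_subset[OF l1_ball_subset_box]) (auto intro: finite_PiE)

lemma card_l1_ball_le_box: "card (l1_ball d m) \<le> (2 * m + 1) ^ d"
proof -
  have "card (l1_ball d m) \<le> card (PiE {..<d} (\<lambda>_. {- int m..int m}))"
    by (intro card_mono l1_ball_subset_box finite_PiE) auto
  also have "\<dots> = (2 * m + 1) ^ d"
    by (simp add: card_PiE nat_add_distrib nat_mult_distrib)
  finally show ?thesis .
qed

lemma l1_ball_0: "l1_ball d 0 = {restrict (\<lambda>_. 0) {..<d}}"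
proof -
  have "(\<Sum>j<d. \<bar>k j\<bar>) \<le> 0 \<longleftrightarrow> (\<forall>j<d. k j = 0)" for k :: "nat \<Rightarrow> int"
  proof -
    have "(\<Sum>j<d. \<bar>k j\<bar>) \<le> 0 \<longleftrightarrow> (\<Sum>j<d. \<bar>k j\<bar>) = 0"
      by (auto intro!: antisym sum_nonneg)
    also have "\<dots> \<longleftrightarrow> (\<forall>j<d. k j = 0)"
      by (subst sum_nonneg_eq_0_iff) auto
    finally show ?thesis .
  qed
  then show ?thesis
    by (auto simp: l1_ball_def frequencies_def PiE_def extensional_def restrict_def fun_eq_iff)
qed

text \<open>
  Moving a nonzero coordinate one step towards 0 lowers the norm by 1; the move is undone by a step
  to a neighbour.
\<close>

lemma l1_ball_Suc_subset:
  "l1_ball d (Suc m) \<subseteq> l1_ball d m \<union>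
     (\<lambda>(k, j, s). k(j := k j + s)) ` (l1_ball d m \<times> {..<d} \<times> {1, - 1})"
proof
  fix k assume k: "k \<in> l1_ball d (Suc m)"
  show "k \<in> l1_ball d m \<union> (\<lambda>(k, j, s). k(j := k j + s)) ` (l1_ball d m \<times> {..<d} \<times> {1, - 1})"
  proof (cases "\<exists>j<d. k j \<noteq> 0")
    case False
    then show ?thesis using k by (simp add: l1_ball_def)
  next
    case True
    then obtain j where j: "j < d" "k j \<noteq> 0" by blast
    let ?k = "k(j := k j - sgn (k j))"
    have "(\<Sum>i<d. \<bar>k i\<bar>) = \<bar>k j\<bar> + (\<Sum>i\<in>{..<d} - {j}. \<bar>k i\<bar>)"
      using j by (intro sum.remove) auto
    moreover have "(\<Sum>i<d. \<bar>?k i\<bar>) = \<bar>?k j\<bar> + (\<Sum>i\<in>{..<d} - {j}. \<bar>?k i\<bar>)"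
      using j by (intro sum.remove) auto
    moreover have "\<bar>?k j\<bar> = \<bar>k j\<bar> - 1"
      using j(2) by (auto simp: sgn_if)
    ultimately have "(\<Sum>i<d. \<bar>?k i\<bar>) = (\<Sum>i<d. \<bar>k i\<bar>) - 1"
      by simp
    then have "?k \<in> l1_ball d m"
      using k j by (auto simp: l1_ball_def frequencies_def PiE_iff extensional_def)
    moreover have "k = ?k(j := ?k j + sgn (k j))" by simp
    moreover have "sgn (k j) \<in> {1, - 1}" using j(2) by (auto simp: sgn_if)
    ultimately show ?thesis
      using j(1) by (intro UnI2 image_eqI[where x = "(?k, j, sgn (k j))"]) auto
  qed
qed

text \<open>
  For fixed \<open>m\<close> this is polynomial in \<open>d\<close>, whereas \<open>card_l1_ball_le_box\<close> is exponential in
  \<open>d\<close> but polynomial in \<open>m\<close>.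
\<close>

lemma card_l1_ball_le_walks: "card (l1_ball d m) \<le> (2 * d + 1) ^ m"
proof (induction m)
  case 0
  then show ?case by (simp add: l1_ball_0)
next
  case (Suc m)
  let ?X = "l1_ball d m \<times> {..<d} \<times> {1, - 1 :: int}"
  have "card (l1_ball d (Suc m))
      \<le> card (l1_ball d m \<union> (\<lambda>(k, j, s). k(j := k j + s)) ` ?X)"
    by (intro card_mono l1_ball_Suc_subset) (auto intro: finite_l1_ball)
  also have "\<dots> \<le> card (l1_ball d m) + card ?X"
    by (intro order_trans[OF card_Un_le] add_left_mono card_image_le) (auto intro: finite_l1_ball)
  also have "card ?X = card (l1_ball d m) * (2 * d)"
    by (simp add: card_cartesian_product)
  also have "card (l1_ball d m) + card (l1_ball d m) * (2 * d) = (2 * d + 1) * card (l1_ball d m)"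
    by (simp add: algebra_simps)
  also have "\<dots> \<le> (2 * d + 1) ^ Suc m"
    unfolding power_Suc using Suc by (rule mult_left_mono) simp
  finally show ?case .
qed

text \<open>
  The exponent of \<open>1 / \<epsilon>\<close> in the radius of the smallest \<open>l\<^sub>1\<close> ball
  that \<open>l1_le_weight\<close> guarantees to contain all frequencies counted at accuracy \<open>\<epsilon>\<close>.
\<close>

fun upper_exponent :: "norm_kind \<Rightarrow> real \<Rightarrow> real" where
  "upper_exponent Plus \<alpha> = 2 / \<alpha>"
| "upper_exponent Star \<alpha> = max 2 (1 / \<alpha>)"
| "upper_exponent Sharp \<alpha> = 1 / \<alpha>"

text \<open>
  The exponent of \<open>1 / \<epsilon>\<close> in the largest number \<open>e\<close> such that the cube
  of vectors with entries 0 and 1 in \<open>e\<close> coordinates is counted at accuracy \<open>\<epsilon>\<close>, up to a constant.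
\<close>

fun lower_exponent :: "norm_kind \<Rightarrow> real \<Rightarrow> real" where
  "lower_exponent Plus \<alpha> = 2 / \<alpha>"
| "lower_exponent Star \<alpha> = 2"
| "lower_exponent Sharp \<alpha> = 1 / \<alpha>"

lemma upper_exponent_pos: "\<alpha> > 0 \<Longrightarrow> upper_exponent b \<alpha> > 0"
  by (cases b) auto

lemma lower_exponent_pos: "\<alpha> > 0 \<Longrightarrow> lower_exponent b \<alpha> > 0"
  by (cases b) auto

text \<open>
  For \<^const>\<open>Plus\<close> this is \<open>\<bar>i\<bar> \<le> i\<^sup>2\<close> for integers, for \<^const>\<open>Sharp\<close> it is
  immediate. For \<^const>\<open>Star\<close> let \<open>T\<close> be the sum of the \<open>\<bar>k j\<bar> powr (2 * \<alpha>)\<close>.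
  A nonzero entry has absolute value at least 1, so
  \<open>\<bar>k j\<bar> \<le> (\<bar>k j\<bar> powr (2 * \<alpha>)) powr r\<close> as soon as \<open>2 * \<alpha> * r \<ge> 1\<close>;
  one factor of the right-hand side is kept, and \<open>r - 1 \<ge> 0\<close> others are bounded by \<open>T\<close>,
  so that the entries add up to at most \<open>T powr r\<close>.
\<close>

lemma l1_le_weight:
  assumes "\<alpha> > 0"
  shows "(\<Sum>j<d. \<bar>real_of_int (k j)\<bar>) \<le> weight b \<alpha> d k powr (upper_exponent b \<alpha> / 2)"
proof (cases b)
  case Plus
  have "(\<Sum>j<d. \<bar>real_of_int (k j)\<bar>) \<le> (\<Sum>j<d. \<bar>real_of_int (k j)\<bar>\<^sup>2)"
  proof (rule sum_mono)
    fix j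
    have "\<bar>k j\<bar> \<le> \<bar>k j\<bar>\<^sup>2"
    proof (cases "k j = 0")
      case False
      then show ?thesis by (intro self_le_power) auto
    qed simp
    then show "\<bar>real_of_int (k j)\<bar> \<le> \<bar>real_of_int (k j)\<bar>\<^sup>2"
      by (metis of_int_abs of_int_le_iff of_int_power)
  qed
  then show ?thesis
    using assms by (simp add: Plus powr_powr sum_nonneg add_nonneg_nonneg del: power2_abs)
next
  case Star
  define T where "T = (\<Sum>j<d. \<bar>real_of_int (k j)\<bar> powr (2 * \<alpha>))"
  define r where "r = max 2 (1 / \<alpha>) / 2"
  have r: "1 \<le> r" "1 \<le> 2 * \<alpha> * r"
    using assms by (auto simp: r_def max_def field_simps)
  have T: "0 \<le> T" unfolding T_def by (intro sum_nonneg) auto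
  have "\<bar>real_of_int (k j)\<bar> \<le> \<bar>real_of_int (k j)\<bar> powr (2 * \<alpha>) * T powr (r - 1)" if "j < d" for j
  proof (cases "k j = 0")
    case False
    let ?u = "\<bar>real_of_int (k j)\<bar>"
    have "1 \<le> \<bar>k j\<bar>" using False by simp
    then have u: "1 \<le> ?u" by (metis of_int_abs of_int_1_le_iff)
    have "?u powr 1 \<le> ?u powr (2 * \<alpha> * r)"
      using r(2) u by (intro powr_mono) auto
    also have "\<dots> = ?u powr (2 * \<alpha>) * (?u powr (2 * \<alpha>)) powr (r - 1)"
      by (simp add: powr_powr powr_add[symmetric] algebra_simps)
    also have "\<dots> \<le> ?u powr (2 * \<alpha>) * T powr (r - 1)"
      using that r(1) unfolding T_def
      by (intro mult_left_mono powr_mono2 member_le_sum[of _ _ "\<lambda>j. \<bar>real_of_int (k j)\<bar> powr (2 * \<alpha>)"]) auto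
    finally show ?thesis using u by simp
  qed simp
  then have "(\<Sum>j<d. \<bar>real_of_int (k j)\<bar>) \<le> T * T powr (r - 1)"
    unfolding sum_distrib_right T_def by (intro sum_mono) (auto simp: T_def)
  also have "\<dots> = T powr r"
    using T by (cases "T = 0") (auto simp: powr_mult_base)
  also have "\<dots> \<le> (1 + T) powr r"
    using T r by (intro powr_mono2) auto
  finally show ?thesis by (simp add: Star T_def r_def)
next
  case Sharp
  then show ?thesis
    using assms by (simp add: powr_powr sum_nonneg add_nonneg_nonneg)
qed

lemma small_weights_subset_l1_ball:
  assumes "\<alpha> > 0" "\<epsilon> > 0"
  shows "small_weights b \<alpha> \<epsilon> d \<subseteq> l1_ball d (nat \<lfloor>(1 / \<epsilon>) powr upper_exponent b \<alpha>\<rfloor>)"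
proof
  fix k assume k: "k \<in> small_weights b \<alpha> \<epsilon> d"
  let ?p = "upper_exponent b \<alpha>"
  have "real_of_int (\<Sum>j<d. \<bar>k j\<bar>) \<le> weight b \<alpha> d k powr (?p / 2)"
    using l1_le_weight[OF assms(1)] by simp
  also have "\<dots> \<le> ((1 / \<epsilon>)\<^sup>2) powr (?p / 2)"
    using k weight_ge_1[OF assms(1), of b d k] upper_exponent_pos[OF assms(1), of b]
    by (intro powr_mono2) (auto simp: small_weights_def)
  also have "\<dots> = (1 / \<epsilon>) powr ?p"
    using assms(2) by (simp flip: powr_numeral add: powr_powr)
  finally have "(\<Sum>j<d. \<bar>k j\<bar>) \<le> \<lfloor>(1 / \<epsilon>) powr ?p\<rfloor>"
    by (simp only: le_floor_iff)
  then show "k \<in> l1_ball d (nat \<lfloor>(1 / \<epsilon>) powr ?p\<rfloor>)"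
    using k by (auto simp: l1_ball_def small_weights_def)
qed

lemma finite_small_weights:
  assumes "\<alpha> > 0" "\<epsilon> > 0"
  shows "finite (small_weights b \<alpha> \<epsilon> d)"
  using small_weights_subset_l1_ball[OF assms] finite_l1_ball by (rule finite_subset)

text \<open>
  The factors 3 absorb the summand 1 in \<open>2 * d + 1\<close> and \<open>2 * m + 1\<close>, because \<open>d\<close> and
  \<open>x\<close> are at least 1.
\<close>

lemma ln_information_complexity_le:
  fixes b :: norm_kind and \<alpha> \<epsilon> :: real and d :: nat
  assumes "\<alpha> > 0" "0 < \<epsilon>" "\<epsilon> < 1" "1 \<le> d"
  defines "x \<equiv> (1 / \<epsilon>) powr upper_exponent b \<alpha>"
  shows "ln (real (information_complexity b \<alpha> \<epsilon> d)) \<le> x * ln (3 * real d)"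
    and "ln (real (information_complexity b \<alpha> \<epsilon> d)) \<le> real d * ln (3 * x)"
proof -
  let ?n = "information_complexity b \<alpha> \<epsilon> d"
  let ?m = "nat \<lfloor>x\<rfloor>"
  have x: "1 \<le> x"
    unfolding x_def using assms upper_exponent_pos[OF assms(1), of b]
    by (intro ge_one_powr_ge_zero) auto
  have m: "real ?m \<le> x" using x by simp
  have n: "?n \<le> card (l1_ball d ?m)"
    unfolding information_complexity_eq_card[OF assms(1,2) finite_small_weights[OF assms(1,2)]] x_def
    by (intro card_mono finite_l1_ball small_weights_subset_l1_ball assms)
  have ln_n: "ln (real ?n) \<le> real e * ln y"
    if "?n \<le> c ^ e" "real c \<le> y" "1 \<le> y" for c e y
  proof (cases "?n = 0")
    case True
    then show ?thesis using that by simp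
  next
    case False
    have "real ?n \<le> real c ^ e"
      using that(1) by (metis of_nat_le_iff of_nat_power)
    also have "\<dots> \<le> y ^ e"
      using that(2) by (intro power_mono) auto
    finally have "ln (real ?n) \<le> ln (y ^ e)"
      using False that(3) by (subst ln_le_cancel_iff) auto
    then show ?thesis using that(3) by (simp add: ln_realpow)
  qed
  have "ln (real ?n) \<le> real ?m * ln (3 * real d)"
    using n card_l1_ball_le_walks[of d ?m] assms(4)
    by (intro ln_n[of "2 * d + 1"]) auto
  also have "\<dots> \<le> x * ln (3 * real d)"
    using m assms(4) by (intro mult_right_mono) auto
  finally show "ln (real ?n) \<le> x * ln (3 * real d)" .
  have "real (2 * ?m + 1) = 2 * real ?m + 1" by (simp only: of_nat_add of_nat_mult of_nat_numeral of_nat_1)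
  also have "\<dots> \<le> 3 * x" using m x by linarith
  finally show "ln (real ?n) \<le> real d * ln (3 * x)"
    by (rule ln_n[OF order_trans[OF n card_l1_ball_le_box]]) (use x in simp)
qed

section \<open>Sufficient conditions\<close>

lemma powr_add_powr_at_top:
  fixes x y :: "nat \<Rightarrow> real"
  assumes "s > 0" "t > 0" and pos: "\<And>k. 0 < x k" "\<And>k. 0 < y k"
    and lim: "filterlim (\<lambda>k. x k + y k) at_top sequentially"
  shows "filterlim (\<lambda>k. x k powr s + y k powr t) at_top sequentially"
  unfolding filterlim_at_top_gt[where c = 0]
proof (intro allI impI)
  fix Z :: real assume "Z > 0"
  have "\<forall>\<^sub>F k in sequentially. Z powr (1 / s) + Z powr (1 / t) < x k + y k"
    using lim unfolding filterlim_at_top_dense by blast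
  then show "\<forall>\<^sub>F k in sequentially. Z \<le> x k powr s + y k powr t"
  proof eventually_elim
    case (elim k)
    have root: "Z \<le> u powr r" if "Z powr (1 / r) \<le> u" "r > 0" for u r
      using powr_mono2[of r "Z powr (1 / r)" u] that \<open>Z > 0\<close> by (simp add: powr_powr)
    from elim have "Z powr (1 / s) \<le> x k \<or> Z powr (1 / t) \<le> y k" by linarith
    then have "Z \<le> x k powr s \<or> Z \<le> y k powr t"
      using root assms by blast
    then show ?case
      by (auto intro: add_increasing add_increasing2)
  qed
qed

text \<open>
  Both cases reduce to a limit in one variable, the denominator \<open>D\<close>: as
  \<open>1 / \<epsilon> \<le> D powr (1 / s)\<close> and \<open>d \<le> D powr (1 / t)\<close>, the logarithm of the complexity is at most
  \<open>D powr q * ln (3 * D powr r)\<close> with \<open>q < 1\<close>, where \<open>q\<close> is \<open>upper_exponent b \<alpha> / s\<close> by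
  the walk bound and \<open>1 / t\<close> by the box bound. Finally \<open>D\<close> tends to infinity with \<open>1 / \<epsilon> + d\<close>.
\<close>

lemma weakly_tractable_sufficient:
  assumes "\<alpha> > 0"
    and st: "(s > upper_exponent b \<alpha> \<and> t > 0) \<or> (s > 0 \<and> t > 1)"
  shows "weakly_tractable b \<alpha> s t"
  unfolding weakly_tractable_def
proof (intro allI impI)
  fix \<epsilon> :: "nat \<Rightarrow> real" and d :: "nat \<Rightarrow> nat"
  assume ed: "\<forall>k. 0 < \<epsilon> k \<and> \<epsilon> k < 1 \<and> 1 \<le> d k"
    and lim: "filterlim (\<lambda>k. inverse (\<epsilon> k) + real (d k)) at_top sequentially"
  let ?p = "upper_exponent b \<alpha>"
  let ?n = "\<lambda>k. information_complexity b \<alpha> (\<epsilon> k) (d k)"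
  define D where "D k = \<epsilon> k powr (- s) + real (d k) powr t" for k
  have p: "?p > 0" using assms(1) by (rule upper_exponent_pos)
  have s: "s > 0" and t: "t > 0" using st p by auto
  have D_eq: "D k = (1 / \<epsilon> k) powr s + real (d k) powr t" for k
    using ed[rule_format, of k] by (simp add: D_def powr_minus powr_divide inverse_eq_divide)
  have D_lim: "filterlim D at_top sequentially"
    unfolding D_eq[abs_def] using s t ed lim
    by (intro powr_add_powr_at_top) (auto simp: inverse_eq_divide Suc_le_eq)
  have D1: "1 \<le> D k" and eps_le: "1 / \<epsilon> k \<le> D k powr (1 / s)" and d_le: "real (d k) \<le> D k powr (1 / t)" for k
  proof -
    have a: "1 \<le> (1 / \<epsilon> k)" "1 \<le> real (d k)"
      using ed[rule_format, of k] by auto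
    show "1 \<le> D k"
      unfolding D_eq using a ge_one_powr_ge_zero[of "1 / \<epsilon> k" s] s by (simp add: add_increasing2)
    have "1 / \<epsilon> k = ((1 / \<epsilon> k) powr s) powr (1 / s)"
      using a s ed[rule_format, of k] by (simp add: powr_powr)
    also have "\<dots> \<le> D k powr (1 / s)"
      unfolding D_eq using s by (intro powr_mono2) auto
    finally show "1 / \<epsilon> k \<le> D k powr (1 / s)" .
    have "real (d k) = (real (d k) powr t) powr (1 / t)"
      using a t by (simp add: powr_powr)
    also have "\<dots> \<le> D k powr (1 / t)"
      unfolding D_eq using t by (intro powr_mono2) auto
    finally show "real (d k) \<le> D k powr (1 / t)" .
  qed
  have x_le: "(1 / \<epsilon> k) powr ?p \<le> D k powr (?p / s)" for k
    using powr_mono2[OF _ _ eps_le[of k], of ?p] ed[rule_format, of k] p by (simp add: powr_powr)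
  have D0: "0 \<le> D k" for k
    using D1[of k] by simp
  obtain q r where q: "q < 1" "r > 0"
    and n: "\<And>k. ln (real (?n k)) \<le> D k powr q * ln (3 * D k powr r)"
  proof (cases "s > ?p")
    case True
    show thesis
    proof (rule that[of "?p / s" "1 / t"])
      fix k
      have "ln (real (?n k)) \<le> (1 / \<epsilon> k) powr ?p * ln (3 * real (d k))"
        using ed assms(1) by (intro ln_information_complexity_le) auto
      also have "\<dots> \<le> D k powr (?p / s) * ln (3 * D k powr (1 / t))"
        using ed[rule_format, of k] x_le[of k] d_le[of k]
        by (intro mult_mono ln_mono) (auto intro!: ln_ge_zero)
      finally show "ln (real (?n k)) \<le> D k powr (?p / s) * ln (3 * D k powr (1 / t))" .
    qed (use True s t in auto)
  next
    case False
    show thesis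
    proof (rule that[of "1 / t" "?p / s"])
      fix k
      have x1: "1 \<le> (1 / \<epsilon> k) powr ?p"
        using ed[rule_format, of k] p by (intro ge_one_powr_ge_zero) auto
      have "ln (real (?n k)) \<le> real (d k) * ln (3 * (1 / \<epsilon> k) powr ?p)"
        using ed assms(1) by (intro ln_information_complexity_le) auto
      also have "\<dots> \<le> D k powr (1 / t) * ln (3 * D k powr (?p / s))"
        using x1 x_le[of k] d_le[of k]
        by (intro mult_mono ln_mono) (auto intro!: ln_ge_zero)
      finally show "ln (real (?n k)) \<le> D k powr (1 / t) * ln (3 * D k powr (?p / s))" .
    qed (use False s p st in auto)
  qed
  have "((\<lambda>z :: real. z powr q * ln (3 * z powr r) / z) \<longlongrightarrow> 0) at_top"
    using q by real_asymp
  then have "(\<lambda>k. D k powr q * ln (3 * D k powr r) / D k) \<longlonglongrightarrow> 0"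
    using D_lim by (rule filterlim_compose)
  then have "(\<lambda>k. ln (real (?n k)) / D k) \<longlonglongrightarrow> 0"
  proof (rule tendsto_sandwich[rotated 3])
    show "\<forall>\<^sub>F k in sequentially. ln (real (?n k)) / D k \<le> D k powr q * ln (3 * D k powr r) / D k"
      using n by (intro always_eventually allI divide_right_mono) (auto simp: D0)
    have "0 \<le> ln (real m)" for m by (cases m) auto
    then show "\<forall>\<^sub>F k in sequentially. 0 \<le> ln (real (?n k)) / D k"
      by (intro always_eventually allI divide_nonneg_nonneg) (auto simp: D0)
  qed auto
  then show "(\<lambda>k. ln (real (?n k)) / (\<epsilon> k powr (- s) + real (d k) powr t)) \<longlonglongrightarrow> 0"
    by (simp add: D_def)
qed

section \<open>Necessary conditions\<close>

text \<open>
  On such vectors all positive powers of the entries agree, which makes the three weights powers of the same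
  number.
\<close>

lemma weight_of_01_vector:
  assumes "\<alpha> > 0" "\<And>j. j < d \<Longrightarrow> k j = 0 \<or> k j = 1"
  shows "weight b \<alpha> d k = (1 + (\<Sum>j<d. real_of_int (k j))) powr (2 / lower_exponent b \<alpha>)"
proof -
  have M: "0 \<le> (\<Sum>j<d. real_of_int (k j))"
    using assms(2) by (intro sum_nonneg) force
  have eq: "(\<Sum>j<d. g (k j)) = (\<Sum>j<d. real_of_int (k j))" if "g 0 = 0" "g 1 = 1" for g
    using assms(2) that by (intro sum.cong) force+
  show ?thesis
    using M assms(1) eq[of "\<lambda>i. \<bar>real_of_int i\<bar>\<^sup>2"] eq[of "\<lambda>i. \<bar>real_of_int i\<bar>"]
      eq[of "\<lambda>i. \<bar>real_of_int i\<bar> powr (2 * \<alpha>)"]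
    by (cases b) (auto simp del: power2_abs)
qed

text \<open>
  The base \<open>2 + e\<close> instead of \<open>1 + e\<close> leaves room for the strict inequality between the
  weights of the cube and \<open>(1 / \<epsilon>)\<^sup>2\<close>. The parameter \<open>e\<close> is independent of \<open>d\<close>, so that
  one of the two arguments \<open>\<epsilon>\<close> and \<open>d\<close> can be kept fixed while the other one varies.
\<close>

lemma information_complexity_ge_cube:
  assumes "\<alpha> > 0" "e \<le> d" "0 < \<epsilon>" "\<epsilon> \<le> (2 + real e) powr (- 1 / lower_exponent b \<alpha>)"
  shows "2 ^ e \<le> information_complexity b \<alpha> \<epsilon> d"
proof -
  let ?q = "lower_exponent b \<alpha>"
  have q: "?q > 0" using assms(1) by (rule lower_exponent_pos)
  define Q :: "(nat \<Rightarrow> int) set" where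
    "Q = PiE {..<d} (\<lambda>j. if j < e then {0, 1} else {0})"
  have "Q \<subseteq> small_weights b \<alpha> \<epsilon> d"
  proof
    fix k assume k: "k \<in> Q"
    then have k01: "k j \<in> (if j < e then {0, 1} else {0})" if "j < d" for j
      using that by (auto simp: Q_def PiE_iff)
    then have k01': "k j = 0 \<or> k j = 1" if "j < d" for j
      using that by (fastforce split: if_splits)
    have k0: "k j = 0" if "e \<le> j" "j < d" for j
      using k01[OF that(2)] that(1) by simp
    have M: "0 \<le> (\<Sum>j<d. real_of_int (k j))"
      using k01' by (intro sum_nonneg) force
    have "(\<Sum>j<d. real_of_int (k j)) = (\<Sum>j<e. real_of_int (k j))"
      using assms(2) k0 by (intro sum.mono_neutral_right) auto
    also have "\<dots> \<le> (\<Sum>j<e. 1)"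
    proof (rule sum_mono)
      fix j assume "j \<in> {..<e}"
      then show "real_of_int (k j) \<le> 1"
        using k01'[of j] assms(2) by auto
    qed
    finally have sum_le: "(\<Sum>j<d. real_of_int (k j)) \<le> real e" by simp
    have "weight b \<alpha> d k = (1 + (\<Sum>j<d. real_of_int (k j))) powr (2 / ?q)"
      using assms(1) k01' by (rule weight_of_01_vector)
    also have "\<dots> < (2 + real e) powr (2 / ?q)"
      using sum_le M q
      by (intro powr_less_mono2) auto
    also have "(2 + real e) powr (2 / ?q) = ((2 + real e) powr (1 / ?q))\<^sup>2"
      by (simp flip: powr_numeral add: powr_powr)
    also have "\<dots> \<le> (1 / \<epsilon>)\<^sup>2"
      using assms(3,4) by (intro power_mono) (auto simp: powr_minus field_simps)
    finally show "k \<in> small_weights b \<alpha> \<epsilon> d"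
      using k by (auto simp: small_weights_def frequencies_def Q_def PiE_iff)
  qed
  moreover have "card Q = 2 ^ e"
  proof -
    have "card Q = (\<Prod>j<d. if j < e then 2 else 1)"
      unfolding Q_def by (subst card_PiE) (auto intro!: prod.cong)
    also have "\<dots> = (\<Prod>j<e. 2)"
      using assms(2) by (intro prod.mono_neutral_cong_right) auto
    finally show ?thesis by simp
  qed
  ultimately show ?thesis
    unfolding information_complexity_eq_card[OF assms(1,3) finite_small_weights[OF assms(1,3)]]
    by (metis card_mono finite_small_weights[OF assms(1,3)])
qed

text \<open>
  If the denominator is at most a multiple of \<open>e\<close>, the quotient stays above \<open>c * ln 2\<close>.
\<close>

lemma not_weakly_tractable_if_cubes:
  fixes \<epsilon> :: "nat \<Rightarrow> real" and d e :: "nat \<Rightarrow> nat"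
  assumes "\<alpha> > 0" "c > 0"
    and cube: "\<And>k. 1 \<le> e k" "\<And>k. e k \<le> d k"
      "\<And>k. 0 < \<epsilon> k" "\<And>k. \<epsilon> k \<le> (2 + real (e k)) powr (- 1 / lower_exponent b \<alpha>)"
    and lim: "filterlim (\<lambda>k. inverse (\<epsilon> k) + real (d k)) at_top sequentially"
    and den: "\<And>k. c * (\<epsilon> k powr (- s) + real (d k) powr t) \<le> real (e k)"
  shows "\<not> weakly_tractable b \<alpha> s t"
proof
  assume wt: "weakly_tractable b \<alpha> s t"
  have q: "lower_exponent b \<alpha> > 0" using assms(1) by (rule lower_exponent_pos)
  have eps1: "\<epsilon> k < 1" for k
  proof -
    have "(2 + real (e k)) powr (- 1 / lower_exponent b \<alpha>) < (2 + real (e k)) powr 0"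
      using q by (intro powr_less_mono) auto
    then show ?thesis using cube(4)[of k] by simp
  qed
  have "\<forall>k. 0 < \<epsilon> k \<and> \<epsilon> k < 1 \<and> 1 \<le> d k"
    using cube eps1 order_trans by blast
  then have "(\<lambda>k. ln (real (information_complexity b \<alpha> (\<epsilon> k) (d k)))
      / (\<epsilon> k powr (- s) + real (d k) powr t)) \<longlonglongrightarrow> 0"
    using wt lim unfolding weakly_tractable_def by blast
  moreover have "c * ln 2 \<le> ln (real (information_complexity b \<alpha> (\<epsilon> k) (d k)))
      / (\<epsilon> k powr (- s) + real (d k) powr t)" for k
  proof -
    let ?n = "information_complexity b \<alpha> (\<epsilon> k) (d k)"
    have pos: "0 < \<epsilon> k powr (- s) + real (d k) powr t"
      using cube(3)[of k] by (intro add_pos_nonneg) auto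
    have n: "2 ^ e k \<le> real ?n"
      using information_complexity_ge_cube[OF assms(1) cube(2-4)]
      by (metis of_nat_le_iff of_nat_numeral of_nat_power)
    have "c * ln 2 * (\<epsilon> k powr (- s) + real (d k) powr t) \<le> real (e k) * ln 2"
      using mult_right_mono[OF den[of k], of "ln 2"] by (simp add: mult_ac)
    also have "\<dots> = ln (2 ^ e k)" by (simp add: ln_realpow)
    also have "\<dots> \<le> ln (real ?n)"
      using n by (intro ln_mono) auto
    finally show ?thesis using pos by (simp add: pos_le_divide_eq)
  qed
  ultimately have "c * ln 2 \<le> 0"
    by (intro LIMSEQ_le_const) auto
  then show False using assms(2) by (simp add: mult_le_0_iff)
qed

lemma weakly_tractable_necessary:
  assumes "\<alpha> > 0" "s \<ge> 0" "t \<ge> 0" and wt: "weakly_tractable b \<alpha> s t"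
  shows "(s > lower_exponent b \<alpha> \<and> t > 0) \<or> (s > 0 \<and> t > 1)"
proof -
  let ?q = "lower_exponent b \<alpha>"
  have q: "?q > 0" using assms(1) by (rule lower_exponent_pos)
  have "s \<noteq> 0"
  proof
    assume "s = 0"
    \<comment> \<open>fixed dimension 1 and growing accuracy: the denominator is constantly 2\<close>
    have "\<not> weakly_tractable b \<alpha> s t"
    proof (rule not_weakly_tractable_if_cubes[where c = "1 / 2" and e = "\<lambda>_. 1" and d = "\<lambda>_. 1"
          and \<epsilon> = "\<lambda>k. 3 powr (- 1 / ?q) / real (Suc k)"])
      show "filterlim (\<lambda>k. inverse (3 powr (- 1 / ?q) / real (Suc k)) + real 1) at_top sequentially"
        by real_asymp
      show "3 powr (- 1 / ?q) / real (Suc k) \<le> (2 + real 1) powr (- 1 / ?q)" for k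
        by (simp add: divide_le_eq mult_le_cancel_left1)
    qed (use assms(1) \<open>s = 0\<close> in auto)
    with wt show False by simp
  qed
  moreover have "t \<noteq> 0"
  proof
    assume "t = 0"
    let ?e = "3 powr (- 1 / ?q) :: real"
    \<comment> \<open>fixed accuracy and growing dimension: the denominator is constant\<close>
    have "\<not> weakly_tractable b \<alpha> s t"
    proof (rule not_weakly_tractable_if_cubes[where c = "1 / (?e powr (- s) + 1)" and e = "\<lambda>_. 1"
          and d = Suc and \<epsilon> = "\<lambda>k. ?e"])
      show "filterlim (\<lambda>k. inverse ?e + real (Suc k)) at_top sequentially"
        by real_asymp
    qed (use assms(1) \<open>t = 0\<close> in \<open>auto simp: add_nonneg_pos\<close>)
    with wt show False by simp
  qed
  moreover have "\<not> (s \<le> ?q \<and> t \<le> 1)"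
  proof
    assume st: "s \<le> ?q \<and> t \<le> 1"
    let ?e = "\<lambda>k. (2 + real (Suc k)) powr (- 1 / ?q)"
    \<comment> \<open>the full cube: both summands of the denominator are at most linear in the dimension\<close>
    have "\<not> weakly_tractable b \<alpha> s t"
    proof (rule not_weakly_tractable_if_cubes[where c = "1 / 4" and e = Suc and d = Suc and \<epsilon> = ?e])
      show "filterlim (\<lambda>k. inverse (?e k) + real (Suc k)) at_top sequentially"
        by (rule filterlim_at_top_mono[OF filterlim_compose[OF filterlim_real_sequentially filterlim_Suc]])
          auto
      show "1 / 4 * (?e k powr (- s) + real (Suc k) powr t) \<le> real (Suc k)" for k
      proof -
        have "?e k powr (- s) = (2 + real (Suc k)) powr (s / ?q)"
          by (simp add: powr_powr)
        also have "\<dots> \<le> (2 + real (Suc k)) powr 1"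
          using st q by (intro powr_mono) auto
        finally have "?e k powr (- s) \<le> 2 + real (Suc k)" by simp
        moreover have "real (Suc k) powr t \<le> real (Suc k) powr 1"
          using st by (intro powr_mono) auto
        ultimately show ?thesis by simp
      qed
    qed (use assms(1) in auto)
    with wt show False by simp
  qed
  ultimately show ?thesis using assms(2,3) by linarith
qed

theorem theorem4p1:
  fixes \<alpha> s t :: real
  assumes "\<alpha> > 0" and "s \<ge> 0" and "t \<ge> 0"
  shows "(weakly_tractable Plus \<alpha> s t \<longleftrightarrow> (s > 2 / \<alpha> \<and> t > 0) \<or> (s > 0 \<and> t > 1)) \<and>
    (weakly_tractable Star \<alpha> s t \<longrightarrow> (s > 2 \<and> t > 0) \<or> (s > 0 \<and> t > 1)) \<and>
    ((s > max 2 (1 / \<alpha>) \<and> t > 0) \<or> (s > 0 \<and> t > 1) \<longrightarrow> weakly_tractable Star \<alpha> s t) \<and>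
    (weakly_tractable Sharp \<alpha> s t \<longleftrightarrow> (s > 1 / \<alpha> \<and> t > 0) \<or> (s > 0 \<and> t > 1))"
proof -
  note suff = weakly_tractable_sufficient[OF assms(1), where s = s and t = t]
  note nec = weakly_tractable_necessary[OF assms]
  show ?thesis
    using suff[of Plus] suff[of Star] suff[of Sharp] nec[of Plus] nec[of Star] nec[of Sharp]
    unfolding upper_exponent.simps lower_exponent.simps by blast
qed

end
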